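(* Let $n\ge 1$ and let $x=(a_1,\dots,a_n)$ and $y=(b_1,\dots,b_n)$ be two permutations in $S_n$. Then $x\leq y$ in the Bruhat(-Chevalley) ordering on $S_n$ if and only if $x\leq_D y$ in the Deodhar ordering on $S_n$.
   Context: Elements of $S_n$ are identified with $n\times n$ permutation matrices; a permutation matrix $v$ is written in one-line notation $v=(v_1,\dots,v_n)$, where $v_j$ is the row index of the nonzero entry in the $j$-th column of $v$. Bruhat–Chevalley ordering: let $\mathbb{F}$ be an algebraically closed field, $GL_n$ the general linear group over $\mathbb{F}$, and $B\subset GL_n$ the subgroup of invertible upper triangular matrices. For $v,w\in S_n$, $v\leq w$ if and only if $BvB\subseteq\overline{BwB}$, the overline denoting Zariski closure in $GL_n$. Deodhar ordering: for an integer vector $a=(a_1,\dots,a_k)$, $\widetilde a$ is the rearrangement of its entries in non-increasing order. For integer vectors $a,b$ of the same length $k$, $a\leq_c b$ means that for every $j=1,\dots,k$ the $j$-th entry of $\widetilde a$ is $\le$ the $j$-th entry of $\widetilde b$. The $k$-th truncation of $a=(a_1,\dots,a_n)$ is $a(k)=(a_1,\dots,a_k)$. For $v,w\in S_n$, $v\leq_D w$ if and only if $\widetilde{v(k)}\leq_c\widetilde{w(k)}$ for all $k=1,\dots,n$. *)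

theory Defs
  imports
    "HOL-Analysis.Abstract_Topology"
    "HOL-Combinatorics.Permutations"
    "HOL-Computational_Algebra.Polynomial"
    "Jordan_Normal_Form.Matrix"
begin

subsection \<open>The Zariski topology on \<open>GL\<^sub>n\<close>\<close>

text \<open>The functions on \<open>n \<times> n\<close> matrices given by polynomials in the \<open>n\<^sup>2\<close> matrix entries.\<close>

inductive_set poly_fun :: "nat \<Rightarrow> ('a::comm_semiring_1 mat \<Rightarrow> 'a) set" for n :: nat where
  const: "(\<lambda>_. c) \<in> poly_fun n"
| entry: "i < n \<Longrightarrow> j < n \<Longrightarrow> (\<lambda>A. A $$ (i, j)) \<in> poly_fun n"
| add: "f \<in> poly_fun n \<Longrightarrow> g \<in> poly_fun n \<Longrightarrow> (\<lambda>A. f A + g A) \<in> poly_fun n"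
| mult: "f \<in> poly_fun n \<Longrightarrow> g \<in> poly_fun n \<Longrightarrow> (\<lambda>A. f A * g A) \<in> poly_fun n"

definition zero_locus :: "nat \<Rightarrow> ('a::comm_semiring_1 mat \<Rightarrow> 'a) set \<Rightarrow> 'a mat set" where
  "zero_locus n S = {A \<in> carrier_mat n n. \<forall>f\<in>S. f A = 0}"

definition zariski_mat :: "nat \<Rightarrow> 'a::idom mat topology" where
  "zariski_mat n = topology (\<lambda>U. \<exists>S \<subseteq> poly_fun n. U = carrier_mat n n - zero_locus n S)"

lemma openin_zariski_mat:
  "openin (zariski_mat n) U \<longleftrightarrow> (\<exists>S \<subseteq> poly_fun n. U = carrier_mat n n - zero_locus n S)"
proof -
  let ?P = "\<lambda>U :: 'a mat set. \<exists>S \<subseteq> poly_fun n. U = carrier_mat n n - zero_locus n S"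
  have "istopology ?P"
    unfolding istopology_def
  proof (intro conjI allI impI)
    fix U V assume "?P U" and "?P V"
    then obtain S T where S: "S \<subseteq> poly_fun n" "U = carrier_mat n n - zero_locus n S"
      and T: "T \<subseteq> poly_fun n" "V = carrier_mat n n - zero_locus n T"
      by blast
    let ?R = "\<Union>f\<in>S. \<Union>g\<in>T. {\<lambda>A. f A * g A}"
    have R: "?R \<subseteq> poly_fun n"
      by (intro UN_least) (simp add: poly_fun.mult subsetD[OF S(1)] subsetD[OF T(1)])
    have "(\<forall>h\<in>?R. h A = 0) \<longleftrightarrow> (\<forall>f\<in>S. f A = 0) \<or> (\<forall>g\<in>T. g A = 0)" for A
      by simp
    then have "zero_locus n ?R = zero_locus n S \<union> zero_locus n T"
      by (simp only: zero_locus_def set_eq_iff Un_iff mem_Collect_eq conj_disj_distribL simp_thms)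
    then have "U \<inter> V = carrier_mat n n - zero_locus n ?R"
      unfolding S(2) T(2) by (simp only: Diff_Un)
    with R show "?P (U \<inter> V)"
      by (intro exI[of _ ?R] conjI)
  next
    fix K assume "\<forall>U\<in>K. ?P U"
    then have "\<exists>S. \<forall>U\<in>K. S U \<subseteq> poly_fun n \<and> U = carrier_mat n n - zero_locus n (S U)"
      by (rule bchoice)
    then obtain S where S: "\<forall>U\<in>K. S U \<subseteq> poly_fun n \<and> U = carrier_mat n n - zero_locus n (S U)"
      by (rule exE)
    have sub: "(\<Union>U\<in>K. S U) \<subseteq> poly_fun n"
      by (rule UN_least) (rule conjunct1[OF bspec[OF S]])
    have "\<Union>K = (\<Union>U\<in>K. U)"
      by simp
    also have "\<dots> = (\<Union>U\<in>K. carrier_mat n n - zero_locus n (S U))"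
      by (rule SUP_cong[OF refl]) (rule conjunct2[OF bspec[OF S]])
    also have "\<dots> = carrier_mat n n - zero_locus n (\<Union>U\<in>K. S U)"
      unfolding zero_locus_def by auto
    finally show "?P (\<Union>K)"
      using sub by (intro exI[of _ "\<Union>U\<in>K. S U"] conjI)
  qed
  then show ?thesis
    unfolding zariski_mat_def by simp
qed

lemma topspace_zariski_mat [simp]: "topspace (zariski_mat n) = carrier_mat n n"
proof
  show "topspace (zariski_mat n) \<subseteq> carrier_mat n n"
    using openin_topspace[of "zariski_mat n"] unfolding openin_zariski_mat by blast
  have "openin (zariski_mat n) (carrier_mat n n)"
    unfolding openin_zariski_mat
    by (rule exI[of _ "{\<lambda>_. 1}"]) (auto simp: zero_locus_def intro: poly_fun.const)
  then show "carrier_mat n n \<subseteq> topspace (zariski_mat n)"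
    by (rule openin_subset)
qed

lemma closedin_zariski_mat:
  "closedin (zariski_mat n) Z \<longleftrightarrow> (\<exists>S \<subseteq> poly_fun n. Z = zero_locus n S)"
proof -
  have "Z \<subseteq> carrier_mat n n \<and> carrier_mat n n - Z = carrier_mat n n - zero_locus n S
      \<longleftrightarrow> Z = zero_locus n S" for S
    unfolding zero_locus_def by blast
  then show ?thesis
    unfolding closedin_def openin_zariski_mat topspace_zariski_mat by blast
qed

definition GL :: "nat \<Rightarrow> 'a::semiring_1 mat set" where
  "GL n = {A \<in> carrier_mat n n. invertible_mat A}"

definition zariski_GL :: "nat \<Rightarrow> 'a::idom mat topology" where
  "zariski_GL n = subtopology (zariski_mat n) (GL n)"

subsection \<open>The Bruhat--Chevalley ordering\<close>

definition borel_subgroup :: "nat \<Rightarrow> 'a::semiring_1 mat set" where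
  "borel_subgroup n = {A \<in> GL n. upper_triangular A}"

text \<open>
  An element of \<open>S\<^sub>n\<close> is a function permuting \<open>{1..n}\<close>, with \<open>v j\<close> the row of the nonzero entry in
  column \<open>j\<close>. Matrix indices start at \<open>0\<close>, whence the shifts.
\<close>

definition perm_matrix :: "nat \<Rightarrow> (nat \<Rightarrow> nat) \<Rightarrow> 'a::semiring_1 mat" where
  "perm_matrix n v = mat n n (\<lambda>(i, j). if v (Suc j) = Suc i then 1 else 0)"

definition double_coset :: "nat \<Rightarrow> (nat \<Rightarrow> nat) \<Rightarrow> 'a::semiring_1 mat set" where
  "double_coset n v =
     {b * perm_matrix n v * c | b c. b \<in> borel_subgroup n \<and> c \<in> borel_subgroup n}"

definition bruhat_le :: "'a::alg_closed_field itself \<Rightarrow> nat \<Rightarrow> (nat \<Rightarrow> nat) \<Rightarrow> (nat \<Rightarrow> nat) \<Rightarrow> bool" where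
  "bruhat_le TYPE('a) n v w \<longleftrightarrow>
     (double_coset n v :: 'a mat set) \<subseteq> Abstract_Topology.closure_of (zariski_GL n) (double_coset n w)"

subsection \<open>The Deodhar ordering\<close>

definition nonincr :: "int list \<Rightarrow> int list" where
  "nonincr a = rev (sort a)"

definition c_le :: "int list \<Rightarrow> int list \<Rightarrow> bool" (infix \<open>\<le>\<^sub>c\<close> 50) where
  "a \<le>\<^sub>c b \<longleftrightarrow> list_all2 (\<le>) (nonincr a) (nonincr b)"

definition one_line :: "nat \<Rightarrow> (nat \<Rightarrow> nat) \<Rightarrow> int list" where
  "one_line n v = map (\<lambda>j. int (v j)) [1..<Suc n]"

definition deodhar_le :: "nat \<Rightarrow> (nat \<Rightarrow> nat) \<Rightarrow> (nat \<Rightarrow> nat) \<Rightarrow> bool" where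
  "deodhar_le n v w \<longleftrightarrow>
     (\<forall>k\<in>{1..n}. nonincr (take k (one_line n v)) \<le>\<^sub>c nonincr (take k (one_line n w)))"

end

theory Submission
  imports Defs "Jordan_Normal_Form.Determinant"
begin

text \<open>
  Both orderings compare the numbers \<open>r\<^sub>v(i, k)\<close> of \<open>j \<le> k\<close> with \<open>v j \<ge> i\<close>. Such a number is the rank
  of the lower left block (rows \<open>\<ge> i\<close>, columns \<open>\<le> k\<close>) of the permutation matrix of \<open>v\<close>, and hence of
  every matrix in \<open>BvB\<close>.

  For the Deodhar ordering this is pure counting: two lists of equal length, once sorted, satisfy
  entrywise \<open>\<le>\<close> exactly when, for each threshold \<open>c\<close>, the second has at least as many entries \<open>\<ge> c\<close> as
  the first (\<open>deodhar_le_iff_rank_count\<close>).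

  If \<open>x\<close> lies below \<open>y\<close> in the Bruhat ordering, then \<open>r\<^sub>x \<le> r\<^sub>y\<close>, because the rank of a block cannot rise
  in a Zariski limit: the minors of size larger than \<open>r\<^sub>y(i, k)\<close> inside the block are polynomial
  functions that vanish on \<open>ByB\<close>, and if \<open>r\<^sub>x(i, k)\<close> were larger, then the minor that selects the
  ones of the block of \<open>x\<close> would be the determinant of an identity matrix
  (\<open>bruhat_le_imp_rank_count_le\<close>).

  Conversely, if \<open>r\<^sub>x \<le> r\<^sub>y\<close> then \<open>y\<close> is reached from \<open>x\<close> by transpositions of positions \<open>p < q\<close> whose
  entries are in increasing order, all without leaving the set of permutations bounded by \<open>r\<^sub>y\<close>
  (\<open>exists_raising_swap\<close>). Each single transposition enlarges the closure of the double coset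
  (\<open>bruhat_le_swap\<close>) because of the \<open>2 \<times> 2\<close> identity, for \<open>t \<noteq> 0\<close>,
  \<open>[1 0; t 1] = [-1/t 1; 0 t] [0 1; 1 0] [1 1/t; 0 1]\<close>:
  the left side is a curve that lies in the double coset of the transposition away from \<open>t = 0\<close> and
  passes through the identity at \<open>t = 0\<close>.
\<close>

section \<open>Rank numbers\<close>

text \<open>
  The rank of the block of rows \<open>\<ge> i\<close> and columns \<open>\<le> k\<close> in the permutation matrix of \<open>v\<close>, for \<open>1 \<le> i\<close>
  and \<open>k \<le> n\<close>.
\<close>

definition rank_count :: "(nat \<Rightarrow> nat) \<Rightarrow> nat \<Rightarrow> nat \<Rightarrow> nat" where
  "rank_count v i k = card {j \<in> {1..k}. i \<le> v j}"

lemma rank_count_eq_sum: "rank_count v i k = (\<Sum>j=1..k. if i \<le> v j then 1 else 0)"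
proof -
  have "{1..k} \<inter> {j. i \<le> v j} = {j \<in> {1..k}. i \<le> v j}" by blast
  then show ?thesis by (simp add: rank_count_def sum.If_cases)
qed

text \<open>
  If sorted entry \<open>t\<close> of \<open>a\<close> exceeded that of \<open>b\<close>, then with that entry of \<open>a\<close> as threshold \<open>c\<close> all positions
  from \<open>t\<close> on would count for \<open>a\<close>, but only positions after \<open>t\<close> could count for \<open>b\<close>.
\<close>

lemma list_all2_sort_iff_count:
  fixes a b :: "'a::linorder list"
  assumes len: "length a = length b"
  shows "list_all2 (\<le>) (sort a) (sort b) \<longleftrightarrow>
    (\<forall>c. length (filter ((\<le>) c) a) \<le> length (filter ((\<le>) c) b))"
proof
  assume L: "list_all2 (\<le>) (sort a) (sort b)"
  have mono: "length (filter ((\<le>) c) u) \<le> length (filter ((\<le>) c) w)"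
    if "list_all2 (\<le>) u w" for c :: 'a and u w
    using that by (induction rule: list_all2_induct) auto
  show "\<forall>c. length (filter ((\<le>) c) a) \<le> length (filter ((\<le>) c) b)"
    using mono[OF L] by (simp add: filter_sort)
next
  assume R: "\<forall>c. length (filter ((\<le>) c) a) \<le> length (filter ((\<le>) c) b)"
  show "list_all2 (\<le>) (sort a) (sort b)"
    unfolding list_all2_conv_all_nth
  proof (intro conjI allI impI)
    fix t assume t: "t < length (sort a)"
    show "sort a ! t \<le> sort b ! t"
    proof (rule ccontr)
      assume "\<not> sort a ! t \<le> sort b ! t"
      define c where "c = sort a ! t"
      have lt: "sort b ! t < c" using \<open>\<not> _\<close> by (simp add: c_def)
      have cnt: "length (filter ((\<le>) c) xs) = card {i. i < length xs \<and> c \<le> sort xs ! i}" for xs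
      proof -
        have "length (filter ((\<le>) c) xs) = length (filter ((\<le>) c) (sort xs))"
          by (simp add: filter_sort)
        then show ?thesis by (simp add: length_filter_conv_card)
      qed
      have "{t..<length a} \<subseteq> {i. i < length a \<and> c \<le> sort a ! i}"
        by (auto simp: c_def intro!: sorted_nth_mono)
      then have 1: "card {t..<length a} \<le> length (filter ((\<le>) c) a)"
        unfolding cnt by (rule card_mono[rotated]) simp
      have "{i. i < length b \<and> c \<le> sort b ! i} \<subseteq> {Suc t..<length b}"
      proof clarsimp
        fix i assume i: "i < length b" "c \<le> sort b ! i"
        show "Suc t \<le> i"
        proof (rule ccontr)
          assume "\<not> Suc t \<le> i"
          then have "sort b ! i \<le> sort b ! t" using t len by (intro sorted_nth_mono) auto
          with i lt show False by simp
        qed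
      qed
      then have 2: "length (filter ((\<le>) c) b) \<le> card {Suc t..<length b}"
        unfolding cnt by (rule card_mono[rotated]) simp
      from 1 2 R[rule_format, of c] t len show False by simp
    qed
  qed (simp add: len)
qed

lemma c_le_iff_count:
  "length a = length b \<Longrightarrow>
    nonincr a \<le>\<^sub>c nonincr b \<longleftrightarrow>
    (\<forall>c. length (filter ((\<le>) c) a) \<le> length (filter ((\<le>) c) b))"
  by (subst list_all2_sort_iff_count[symmetric])
    (simp_all add: c_le_def nonincr_def sort_key_id_if_sorted
      properties_for_sort[OF mset_rev] sorted_sort)

lemma count_truncation:
  assumes "k \<le> n"
  shows "length (filter ((\<le>) c) (take k (one_line n v))) = rank_count v (nat c) k"
proof -
  have "take k (one_line n v) = map (\<lambda>j. int (v j)) [1..<Suc k]"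
    using assms by (simp add: one_line_def take_map take_upt del: upt_Suc)
  then have "length (filter ((\<le>) c) (take k (one_line n v)))
      = length (filter (\<lambda>j. c \<le> int (v j)) [1..<Suc k])"
    by (simp add: length_filter_map comp_def del: upt_Suc)
  also have "\<dots> = card ({j. c \<le> int (v j)} \<inter> {1..k})"
    by (subst distinct_length_filter) (auto simp del: upt_Suc simp: atLeastLessThanSuc_atLeastAtMost)
  also have "{j. c \<le> int (v j)} \<inter> {1..k} = {j \<in> {1..k}. nat c \<le> v j}" by auto
  finally show ?thesis by (simp add: rank_count_def)
qed

lemma deodhar_le_iff_rank_count:
  "deodhar_le n x y \<longleftrightarrow> (\<forall>k\<in>{1..n}. \<forall>i. rank_count x i k \<le> rank_count y i k)"
proof -
  have "nonincr (take k (one_line n x)) \<le>\<^sub>c nonincr (take k (one_line n y)) \<longleftrightarrow>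
      (\<forall>i. rank_count x i k \<le> rank_count y i k)" if "k \<in> {1..n}" for k
  proof -
    have "length (take k (one_line n x)) = length (take k (one_line n y))"
      by (simp add: one_line_def)
    then have "nonincr (take k (one_line n x)) \<le>\<^sub>c nonincr (take k (one_line n y)) \<longleftrightarrow>
      (\<forall>c. rank_count x (nat c) k \<le> rank_count y (nat c) k)"
      using that by (simp add: c_le_iff_count count_truncation)
    also have "\<dots> \<longleftrightarrow> (\<forall>i. rank_count x i k \<le> rank_count y i k)"
      by (metis nat_int)
    finally show ?thesis .
  qed
  then show ?thesis by (simp add: deodhar_le_def)
qed

section \<open>Raising a permutation towards a larger one\<close>

text \<open>
  Exchanging a smaller entry at \<open>p\<close> with a larger one at \<open>q\<close> changes which entries have been seen only
  for prefixes ending in \<open>[p, q)\<close>, where \<open>v p\<close> is replaced by \<open>v q\<close>.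
\<close>

lemma rank_count_swap:
  assumes "1 \<le> p" "p < q" "v p < v q"
  shows "rank_count (v \<circ> transpose p q) i k =
    rank_count v i k + (if p \<le> k \<and> k < q \<and> v p < i \<and> i \<le> v q then 1 else 0)"
proof -
  let ?f = "\<lambda>u j. if i \<le> u j then 1 else 0 :: nat"
  let ?v' = "v \<circ> transpose p q"
  consider "k < p" | "p \<le> k" "k < q" | "q \<le> k" by linarith
  then show ?thesis
  proof cases
    case 1
    then have "{j \<in> {1..k}. i \<le> ?v' j} = {j \<in> {1..k}. i \<le> v j}"
      using assms by (auto simp: transpose_def)
    then show ?thesis using 1 by (simp add: rank_count_def)
  next
    case 2
    have "rank_count u i k = ?f u p + sum (?f u) ({1..k} - {p})" for u
      unfolding rank_count_eq_sum using 2 assms by (intro sum.remove) auto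
    moreover have "sum (?f ?v') ({1..k} - {p}) = sum (?f v) ({1..k} - {p})"
      using 2 by (intro sum.cong) (auto simp: transpose_def)
    ultimately show ?thesis using 2 assms by (simp add: transpose_def)
  next
    case 3
    have "rank_count u i k = ?f u p + (?f u q + sum (?f u) ({1..k} - {p} - {q}))" for u
    proof -
      have "sum (?f u) ({1..k} - {p}) = ?f u q + sum (?f u) ({1..k} - {p} - {q})"
        using 3 assms by (intro sum.remove) auto
      moreover have "rank_count u i k = ?f u p + sum (?f u) ({1..k} - {p})"
        unfolding rank_count_eq_sum using 3 assms by (intro sum.remove) auto
      ultimately show ?thesis by simp
    qed
    moreover have "sum (?f ?v') ({1..k} - {p} - {q}) = sum (?f v) ({1..k} - {p} - {q})"
      by (intro sum.cong) (auto simp: transpose_def)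
    ultimately show ?thesis using 3 assms by (simp add: transpose_def)
  qed
qed

text \<open>
  Let \<open>p\<close> be the first position where \<open>x\<close> and \<open>y\<close> differ; the bounds at \<open>k = p\<close> force \<open>x p < y p\<close>.
  Let \<open>q\<close> be the first later position whose entry lies in \<open>(x p, y p]\<close>; the position of the value \<open>y p\<close>
  in \<open>x\<close> is a candidate. The swap raises \<open>r\<^sub>x(i, k)\<close> by one exactly for \<open>k \<in> [p, q)\<close> and
  \<open>i \<in> (x p, x q]\<close>, and there \<open>r\<^sub>x(i, k) < r\<^sub>y(i, k)\<close> holds already. To see this, compare the bands of
  entries in \<open>[i, y p]\<close> among the first \<open>k\<close> positions. By the choice of \<open>q\<close> those of \<open>x\<close> occur only before
  \<open>p\<close>, where \<open>x\<close> and \<open>y\<close> agree, whereas \<open>y\<close> has the additional position \<open>p\<close>. Above the bands the given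
  bound for the threshold \<open>y p + 1\<close> applies.
\<close>

lemma exists_raising_swap:
  assumes x: "x permutes {1..n}" and y: "y permutes {1..n}" and ne: "x \<noteq> y"
    and le: "\<And>i k. k \<in> {1..n} \<Longrightarrow> rank_count x i k \<le> rank_count y i k"
  obtains p q where "1 \<le> p" "p < q" "q \<le> n" "x p < x q"
    "\<And>i k. k \<in> {1..n} \<Longrightarrow> rank_count (x \<circ> transpose p q) i k \<le> rank_count y i k"
proof -
  define p where "p = (LEAST j. x j \<noteq> y j)"
  have xyp: "x p \<noteq> y p" 
  proof -
    from ne obtain j where "x j \<noteq> y j" by blast
    then show ?thesis unfolding p_def by (rule LeastI[where P = "\<lambda>j. x j \<noteq> y j"])
  qed
  have before: "x j = y j" if "j < p" for j using that not_less_Least unfolding p_def by blast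
  have p: "p \<in> {1..n}" using xyp permutes_not_in[OF x] permutes_not_in[OF y] by metis
  have split_p: "rank_count v i p = rank_count v i (p - 1) + (if i \<le> v p then 1 else 0)" for v i
    using p by (cases p) (simp_all add: rank_count_eq_sum)
  have same_before: "rank_count x i (p - 1) = rank_count y i (p - 1)" for i
  proof -
    have "{j \<in> {1..p-1}. i \<le> x j} = {j \<in> {1..p-1}. i \<le> y j}"
      using before by auto
    then show ?thesis by (simp add: rank_count_def)
  qed
  have "x p \<le> y p"
    using le[OF p, of "x p"] same_before[of "x p"] by (simp add: split_p split: if_splits)
  with xyp have xp: "x p < y p" by simp
  define P where "P = (\<lambda>j. p < j \<and> x p < x j \<and> x j \<le> y p)"
  obtain m where m: "m \<in> {1..n}" "x m = y p"
    using permutes_image[OF x] permutes_in_image[OF y] p by (metis imageE)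
  have "P m"
  proof -
    have "m \<noteq> p" using m xyp by auto
    moreover have "\<not> m < p"
    proof
      assume "m < p"
      then have "y m = y p" using before m by auto
      with \<open>m < p\<close> show False using permutes_inj[OF y] by (auto dest: injD)
    qed
    ultimately show ?thesis using m xp by (simp add: P_def)
  qed
  define q where "q = (LEAST j. P j)"
  have q: "P q" unfolding q_def using \<open>P m\<close> by (rule LeastI)
  have "q \<le> n" unfolding q_def using Least_le[of P m] \<open>P m\<close> m by auto
  have between: "\<not> P j" if "j < q" for j using that not_less_Least unfolding q_def by blast
  show ?thesis
  proof (rule that[of p q])
    show "1 \<le> p" "p < q" "q \<le> n" "x p < x q" using p q \<open>q \<le> n\<close> by (auto simp: P_def)
    fix i k assume k: "k \<in> {1..n}"
    have "rank_count x i k < rank_count y i k" if c: "p \<le> k" "k < q" "x p < i" "i \<le> x q"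
    proof -
      have iy: "i \<le> y p" using c q by (simp add: P_def)
      let ?top = "Suc (y p)"
      have band: "rank_count v i k = rank_count v ?top k + card {j \<in> {1..k}. i \<le> v j \<and> v j \<le> y p}" for v
      proof -
        have "{j \<in> {1..k}. i \<le> v j} =
            {j \<in> {1..k}. ?top \<le> v j} \<union> {j \<in> {1..k}. i \<le> v j \<and> v j \<le> y p}"
          using iy by auto
        then show ?thesis unfolding rank_count_def by (subst card_Un_disjoint[symmetric]) auto
      qed
      have "{j \<in> {1..k}. i \<le> x j \<and> x j \<le> y p} \<subset> {j \<in> {1..k}. i \<le> y j \<and> y j \<le> y p}"
      proof (rule psubsetI)
        show "{j \<in> {1..k}. i \<le> x j \<and> x j \<le> y p} \<subseteq> {j \<in> {1..k}. i \<le> y j \<and> y j \<le> y p}"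
        proof clarsimp
          fix j assume j: "Suc 0 \<le> j" "j \<le> k" "i \<le> x j" "x j \<le> y p"
          then have "\<not> p < j" using between[of j] c by (auto simp: P_def)
          moreover have "j \<noteq> p" using j c by auto
          ultimately show "i \<le> y j \<and> y j \<le> y p" using before[of j] j by auto
        qed
        have "p \<in> {j \<in> {1..k}. i \<le> y j \<and> y j \<le> y p}" using p c iy by auto
        moreover have "p \<notin> {j \<in> {1..k}. i \<le> x j \<and> x j \<le> y p}" using c by auto
        ultimately show "{j \<in> {1..k}. i \<le> x j \<and> x j \<le> y p} \<noteq> {j \<in> {1..k}. i \<le> y j \<and> y j \<le> y p}"
          by metis
      qed
      then have "card {j \<in> {1..k}. i \<le> x j \<and> x j \<le> y p} < card {j \<in> {1..k}. i \<le> y j \<and> y j \<le> y p}"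
        by (intro psubset_card_mono) auto
      then show ?thesis using le[OF k, of ?top] band[of x] band[of y] by simp
    qed
    then show "rank_count (x \<circ> transpose p q) i k \<le> rank_count y i k"
      using le[OF k, of i] p q by (subst rank_count_swap) (auto simp: P_def Suc_le_eq)
  qed
qed

text \<open>
  Raising swaps terminate because, by the rearrangement inequality, each of them lowers
  \<open>\<Sum>j. j * x j\<close>.
\<close>

lemma rank_count_le_induct [consumes 3, case_names refl swap]:
  assumes x: "x permutes {1..n}" and y: "y permutes {1..n}"
    and le: "\<forall>k\<in>{1..n}. \<forall>i. rank_count x i k \<le> rank_count y i k"
    and refl: "P y"
    and swap: "\<And>x p q. x permutes {1..n} \<Longrightarrow> 1 \<le> p \<Longrightarrow> p < q \<Longrightarrow> q \<le> n \<Longrightarrow> x p < x q \<Longrightarrow>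
      P (x \<circ> transpose p q) \<Longrightarrow> P x"
  shows "P x"
  using x le
proof (induction "\<Sum>j=1..n. j * x j" arbitrary: x rule: less_induct)
  case less
  show ?case
  proof (cases "x = y")
    case False
    from exists_raising_swap[OF less.prems(1) y False] less.prems(2)
    obtain p q where pq: "1 \<le> p" "p < q" "q \<le> n" "x p < x q"
      and le': "\<forall>k\<in>{1..n}. \<forall>i. rank_count (x \<circ> transpose p q) i k \<le> rank_count y i k"
      by metis
    let ?x' = "x \<circ> transpose p q"
    have x': "?x' permutes {1..n}"
      using pq less.prems(1) by (intro permutes_compose permutes_swap_id) auto
    have sp: "(\<Sum>j=1..n. j * u j) = p * u p + (q * u q + (\<Sum>j\<in>{1..n}-{p}-{q}. j * u j))"
      for u :: "nat \<Rightarrow> nat"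
      using pq by (subst sum.remove[of _ p], simp_all, subst sum.remove[of _ q], auto)
    have rest: "(\<Sum>j\<in>{1..n}-{p}-{q}. j * ?x' j) = (\<Sum>j\<in>{1..n}-{p}-{q}. j * x j)"
      by (intro sum.cong) (auto simp: transpose_def)
    have "p * x q + q * x p < p * x p + q * x q"
    proof -
      obtain d e where "q = p + d" "d > 0" "x q = x p + e" "e > 0"
        using pq by (metis less_imp_add_positive)
      then show ?thesis by (simp add: algebra_simps)
    qed
    then have "(\<Sum>j=1..n. j * ?x' j) < (\<Sum>j=1..n. j * x j)"
      unfolding sp[of ?x'] sp[of x] rest by (simp add: transpose_def)
    from less.hyps[OF this x' le'] show ?thesis using swap[OF less.prems(1) pq] by blast
  qed (use refl in simp)
qed

section \<open>Polynomial functions and the Zariski closure\<close>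

lemma poly_fun_sum:
  "finite S \<Longrightarrow> (\<And>s. s \<in> S \<Longrightarrow> g s \<in> poly_fun n) \<Longrightarrow> (\<lambda>A. \<Sum>s\<in>S. g s A) \<in> poly_fun n"
proof (induction S rule: finite_induct)
  case empty
  show ?case unfolding sum.empty by (rule poly_fun.const)
next
  case (insert s S)
  show ?case unfolding sum.insert[OF insert.hyps]
    by (rule poly_fun.add) (rule insert.prems insert.IH; blast intro: insert.prems)+
qed

lemma poly_fun_prod:
  "finite S \<Longrightarrow> (\<And>s. s \<in> S \<Longrightarrow> g s \<in> poly_fun n) \<Longrightarrow> (\<lambda>A. \<Prod>s\<in>S. g s A) \<in> poly_fun n"
proof (induction S rule: finite_induct)
  case empty
  show ?case unfolding prod.empty by (rule poly_fun.const)
next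
  case (insert s S)
  show ?case unfolding prod.insert[OF insert.hyps]
    by (rule poly_fun.mult) (rule insert.prems insert.IH; blast intro: insert.prems)+
qed

lemma poly_fun_minor:
  assumes "\<And>s. s < m \<Longrightarrow> r s < n" "\<And>s. s < m \<Longrightarrow> c s < n"
  shows "(\<lambda>A :: 'a::comm_ring_1 mat. det (mat m m (\<lambda>(s, t). A $$ (r s, c t)))) \<in> poly_fun n"
proof -
  have "det (mat m m (\<lambda>(s, t). A $$ (r s, c t))) =
      (\<Sum>\<pi>\<in>{\<pi>. \<pi> permutes {0..<m}}. signof \<pi> * (\<Prod>s = 0..<m. A $$ (r s, c (\<pi> s))))"
    for A :: "'a mat"
    by (subst det_def'[of _ m], simp, intro sum.cong refl arg_cong2[of _ _ _ _ "(*)"] prod.cong)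
      (auto dest: permutes_in_image)
  moreover have "c (\<pi> s) < n" if "\<pi> permutes {0..<m}" "s < m" for \<pi> s
    using assms(2) that permutes_in_image[OF that(1), of s] by auto
  ultimately show ?thesis
    using assms(1)
    by (simp only:, intro poly_fun_sum poly_fun.mult[OF poly_fun.const] poly_fun_prod)
      (simp_all add: poly_fun.entry finite_permutations)
qed

lemma poly_fun_along_curve:
  assumes "f \<in> poly_fun n"
    and "\<And>i j. i < n \<Longrightarrow> j < n \<Longrightarrow> \<exists>p. \<forall>t. M t $$ (i, j) = poly p t"
  shows "\<exists>p. \<forall>t. f (M t) = poly p t"
  using assms(1)
proof induction
  case (const c)
  show ?case by (rule exI[of _ "[:c:]"]) simp
next
  case (add f g)
  then show ?case by (metis poly_add)
next
  case (mult f g)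
  then show ?case by (metis poly_mult)
qed (use assms(2) in blast)

text \<open>
  The polynomial \<open>1 + X * p\<close> has no root: it equals \<open>1\<close> at \<open>0\<close>, and also wherever \<open>p\<close> vanishes. Over an
  algebraically closed field it is therefore constant, so \<open>p = 0\<close>.
\<close>

lemma poly_zero_at_0_if_zero_elsewhere:
  fixes p :: "'a::alg_closed_field poly"
  assumes "\<And>t. t \<noteq> 0 \<Longrightarrow> poly p t = 0"
  shows "poly p 0 = 0"
proof (rule ccontr)
  assume "poly p 0 \<noteq> 0"
  then have "degree (pCons 1 p) > 0" by auto
  then obtain t where "poly (pCons 1 p) t = 0" using alg_closed_imp_poly_has_root by blast
  then show False using assms[of t] by (cases "t = 0") auto
qed

text \<open>
  A matrix joined to a set by a curve with polynomial entries lies in the Zariski closure of the set.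
\<close>

lemma poly_fun_vanishes_at_limit:
  fixes M :: "'a::alg_closed_field \<Rightarrow> 'a mat"
  assumes "f \<in> poly_fun n"
    and "\<And>i j. i < n \<Longrightarrow> j < n \<Longrightarrow> \<exists>p. \<forall>t. M t $$ (i, j) = poly p t"
    and "\<And>t. t \<noteq> 0 \<Longrightarrow> f (M t) = 0"
  shows "f (M 0) = 0"
proof -
  obtain p where "\<And>t. f (M t) = poly p t"
    using poly_fun_along_curve[OF assms(1), of M] assms(2) by blast
  then show ?thesis using poly_zero_at_0_if_zero_elsewhere[of p] assms(3) by simp
qed

lemma GL_carrier: "A \<in> GL n \<Longrightarrow> A \<in> carrier_mat n n"
  by (simp add: GL_def)

lemma topspace_zariski_GL: "topspace (zariski_GL n) = GL n"
  unfolding zariski_GL_def topspace_subtopology topspace_zariski_mat GL_def by blast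

lemma in_closure_zariski_GL_iff:
  fixes S :: "'a::idom mat set"
  assumes S: "S \<subseteq> GL n"
  shows "A \<in> Abstract_Topology.closure_of (zariski_GL n) S \<longleftrightarrow>
    A \<in> GL n \<and> (\<forall>f\<in>poly_fun n. (\<forall>B\<in>S. f B = 0) \<longrightarrow> f A = 0)"
proof
  assume A: "A \<in> Abstract_Topology.closure_of (zariski_GL n) S"
  have "f A = 0" if f: "f \<in> poly_fun n" and f0: "\<forall>B\<in>S. f B = 0" for f
  proof -
    have "closedin (zariski_GL n) (zero_locus n {f} \<inter> GL n)"
      unfolding zariski_GL_def closedin_subtopology closedin_zariski_mat
      by (intro exI[of _ "zero_locus n {f}"] exI[of _ "{f}"] conjI refl) (simp add: f)
    moreover have "S \<subseteq> zero_locus n {f} \<inter> GL n"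
      using S f0 GL_carrier unfolding zero_locus_def by blast
    ultimately have "A \<in> zero_locus n {f} \<inter> GL n"
      using A closure_of_minimal by blast
    then show ?thesis by (simp add: zero_locus_def)
  qed
  moreover have "A \<in> GL n"
    using A closure_of_subset_topspace[of "zariski_GL n" S]
    unfolding topspace_zariski_GL by (rule subsetD[rotated])
  ultimately show "A \<in> GL n \<and> (\<forall>f\<in>poly_fun n. (\<forall>B\<in>S. f B = 0) \<longrightarrow> f A = 0)" by blast
next
  assume A: "A \<in> GL n \<and> (\<forall>f\<in>poly_fun n. (\<forall>B\<in>S. f B = 0) \<longrightarrow> f A = 0)"
  have "closedin (zariski_GL n) (Abstract_Topology.closure_of (zariski_GL n) S)" by simp
  then obtain F where F: "F \<subseteq> poly_fun n" "Abstract_Topology.closure_of (zariski_GL n) S = zero_locus n F \<inter> GL n"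
    unfolding zariski_GL_def closedin_subtopology closedin_zariski_mat by blast
  have "S \<subseteq> Abstract_Topology.closure_of (zariski_GL n) S"
    using S by (intro closure_of_subset) (simp add: topspace_zariski_GL)
  then have "\<forall>f\<in>F. \<forall>B\<in>S. f B = 0" unfolding F(2) zero_locus_def by blast
  then have "A \<in> zero_locus n F \<inter> GL n"
    using A F(1) GL_carrier unfolding zero_locus_def by blast
  then show "A \<in> Abstract_Topology.closure_of (zariski_GL n) S" by (simp add: F(2))
qed

section \<open>Double cosets of permutation matrices\<close>

lemma GL_iff_det_nonzero:
  fixes A :: "'a::field mat"
  shows "A \<in> GL n \<longleftrightarrow> A \<in> carrier_mat n n \<and> det A \<noteq> 0"
proof
  assume "A \<in> GL n"
  then obtain B where A: "A \<in> carrier_mat n n" and AB: "A * B = 1\<^sub>m n" and BA: "B * A = 1\<^sub>m (dim_row B)"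
    by (auto simp: GL_def invertible_mat_def inverts_mat_def)
  have "dim_col B = n" using arg_cong[OF AB, of dim_col] by simp
  moreover have "dim_row B = n" using arg_cong[OF BA, of dim_col] A by simp
  ultimately have "B \<in> carrier_mat n n" by blast
  then have "det A * det B = 1" using det_mult[OF A, of B] AB by simp
  then show "A \<in> carrier_mat n n \<and> det A \<noteq> 0" using A by auto
next
  assume A: "A \<in> carrier_mat n n \<and> det A \<noteq> 0"
  then obtain B where "B \<in> carrier_mat n n" "B * A = 1\<^sub>m n" "A * B = 1\<^sub>m n"
    using det_non_zero_imp_unit[of A n] by (auto simp: Units_def ring_mat_def)
  then show "A \<in> GL n"
    using A by (auto simp: GL_def invertible_mat_def inverts_mat_def)
qed

lemma GL_mult: "A \<in> GL n \<Longrightarrow> B \<in> GL n \<Longrightarrow> A * B \<in> GL n"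
  for A B :: "'a::field mat"
  by (auto simp: GL_iff_det_nonzero det_mult)

lemma borel_subgroupI:
  fixes A :: "'a::field mat"
  assumes A: "A \<in> carrier_mat n n" and "upper_triangular A" and "\<And>i. i < n \<Longrightarrow> A $$ (i, i) \<noteq> 0"
  shows "A \<in> borel_subgroup n"
proof -
  have "det A \<noteq> 0"
    using assms by (subst det_upper_triangular) (auto simp: diag_mat_def prod_list_zero_iff)
  then show ?thesis using assms by (simp add: borel_subgroup_def GL_iff_det_nonzero)
qed

lemma one_in_borel_subgroup: "1\<^sub>m n \<in> (borel_subgroup n :: 'a::field mat set)"
  by (intro borel_subgroupI) auto

lemma borel_subgroup_carrier: "A \<in> borel_subgroup n \<Longrightarrow> A \<in> carrier_mat n n"
  by (simp add: borel_subgroup_def GL_def)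

lemma borel_subgroup_lower: "A \<in> borel_subgroup n \<Longrightarrow> j < i \<Longrightarrow> i < n \<Longrightarrow> A $$ (i, j) = 0"
  using borel_subgroup_carrier[of A n] by (auto simp: borel_subgroup_def)

lemma borel_subgroup_mult:
  fixes A B :: "'a::field mat"
  assumes A: "A \<in> borel_subgroup n" and B: "B \<in> borel_subgroup n"
  shows "A * B \<in> borel_subgroup n"
proof -
  note car = borel_subgroup_carrier[OF A] borel_subgroup_carrier[OF B]
  have "(A * B) $$ (i, j) = 0" if ij: "j < i" "i < n" for i j
  proof -
    have "A $$ (i, k) * B $$ (k, j) = 0" if "k < n" for k
      using borel_subgroup_lower[OF A, of k i] borel_subgroup_lower[OF B, of j k] ij that
      by (cases "k < i") auto
    then show ?thesis using car ij by (auto simp: scalar_prod_def intro!: sum.neutral)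
  qed
  then have "upper_triangular (A * B)" using car by auto
  moreover have "A * B \<in> GL n" using A B GL_mult by (auto simp: borel_subgroup_def)
  ultimately show ?thesis by (simp add: borel_subgroup_def)
qed

lemma perm_matrix_carrier [simp]: "perm_matrix n v \<in> carrier_mat n n"
  by (simp add: perm_matrix_def)

lemma permutes_pred:
  assumes "v permutes {1..n}" "j < n"
  shows "v (Suc j) - 1 < n" "Suc (v (Suc j) - 1) = v (Suc j)"
  using permutes_in_image[OF assms(1), of "Suc j"] assms(2) by auto

lemma mult_perm_matrix_entry:
  fixes b :: "'a::semiring_1 mat"
  assumes v: "v permutes {1..n}" and b: "b \<in> carrier_mat n n" and ij: "i < n" "j < n"
  shows "(b * perm_matrix n v) $$ (i, j) = b $$ (i, v (Suc j) - 1)"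
proof -
  note vj = permutes_pred[OF v ij(2)]
  have "(b * perm_matrix n v) $$ (i, j) =
      (\<Sum>k = 0..<n. b $$ (i, k) * (if v (Suc j) = Suc k then 1 else 0))"
    using b ij by (simp add: perm_matrix_def scalar_prod_def)
  also have "\<dots> = (\<Sum>k = 0..<n. if k = v (Suc j) - 1 then b $$ (i, k) else 0)"
    using vj by (intro sum.cong) auto
  also have "\<dots> = b $$ (i, v (Suc j) - 1)" using vj by simp
  finally show ?thesis .
qed

lemma double_coset_entry:
  fixes b c :: "'a::semiring_1 mat"
  assumes v: "v permutes {1..n}" and b: "b \<in> carrier_mat n n" and c: "c \<in> carrier_mat n n"
    and "i < n" "k < n"
  shows "(b * perm_matrix n v * c) $$ (i, k) = (\<Sum>j<n. b $$ (i, v (Suc j) - 1) * c $$ (j, k))"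
proof -
  have "(b * perm_matrix n v * c) $$ (i, k) =
      (\<Sum>j = 0..<n. (b * perm_matrix n v) $$ (i, j) * c $$ (j, k))"
    using assms by (simp add: scalar_prod_def perm_matrix_def)
  also have "\<dots> = (\<Sum>j<n. b $$ (i, v (Suc j) - 1) * c $$ (j, k))"
    unfolding lessThan_atLeast0 using assms by (intro sum.cong) (auto simp: mult_perm_matrix_entry)
  finally show ?thesis .
qed

text \<open>
  The inverse is the matrix of the inverse permutation.
\<close>

lemma perm_matrix_in_GL:
  assumes v: "v permutes {1..n}"
  shows "(perm_matrix n v :: 'a::field mat) \<in> GL n"
proof -
  let ?w = "inv_into UNIV v"
  have w: "?w permutes {1..n}" using v by (rule permutes_inv)
  have "perm_matrix n v * perm_matrix n ?w = (1\<^sub>m n :: 'a mat)"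
  proof (rule eq_matI)
    fix i j assume "i < dim_row (1\<^sub>m n :: 'a mat)" "j < dim_col (1\<^sub>m n :: 'a mat)"
    then have ij: "i < n" "j < n" by auto
    show "(perm_matrix n v * perm_matrix n ?w) $$ (i, j) = (1\<^sub>m n :: 'a mat) $$ (i, j)"
      using ij permutes_pred[OF w ij(2)] permutes_inverses(1)[OF v]
      by (subst mult_perm_matrix_entry[OF w _ ij]) (auto simp: perm_matrix_def)
  qed (auto simp: perm_matrix_def)
  then have "det (perm_matrix n v :: 'a mat) * det (perm_matrix n ?w) = 1"
    by (subst det_mult[symmetric, of _ n]) auto
  then show ?thesis by (auto simp: GL_iff_det_nonzero)
qed

lemma double_coset_subset_GL:
  assumes "v permutes {1..n}"
  shows "(double_coset n v :: 'a::field mat set) \<subseteq> GL n"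
  using perm_matrix_in_GL[OF assms] by (auto simp: double_coset_def borel_subgroup_def intro!: GL_mult)

lemma perm_matrix_in_double_coset: "perm_matrix n v \<in> (double_coset n v :: 'a::field mat set)"
proof -
  have "perm_matrix n v = 1\<^sub>m n * perm_matrix n v * (1\<^sub>m n :: 'a mat)"
    by (simp add: right_mult_one_mat[of _ n n] left_mult_one_mat[of _ n n])
  then show ?thesis unfolding double_coset_def using one_in_borel_subgroup by blast
qed

lemma double_coset_mult:
  fixes A :: "'a::field mat"
  assumes A: "A \<in> double_coset n v" and b: "b \<in> borel_subgroup n" and c: "c \<in> borel_subgroup n"
  shows "b * A * c \<in> double_coset n v"
proof -
  obtain b' c' where A_eq: "A = b' * perm_matrix n v * c'"
    and b': "b' \<in> borel_subgroup n" and c': "c' \<in> borel_subgroup n"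
    using A by (auto simp: double_coset_def)
  note [simp] = borel_subgroup_carrier[OF b] borel_subgroup_carrier[OF b']
    borel_subgroup_carrier[OF c] borel_subgroup_carrier[OF c']
  have "b * A * c = (b * b') * perm_matrix n v * (c' * c)"
    by (simp add: A_eq assoc_mult_mat[of _ n n _ n _ n] mult_carrier_mat[of _ n n _ n])
  then show ?thesis
    unfolding double_coset_def using borel_subgroup_mult[OF b b'] borel_subgroup_mult[OF c' c] by blast
qed

section \<open>Closure relations bound the rank numbers\<close>

text \<open>
  The matrix factors through a space of dimension \<open>card J\<close>. Padding the factors to square matrices gives
  the right one a zero row.
\<close>

lemma det_eq_0_if_factors:
  fixes f :: "nat \<Rightarrow> 'b \<Rightarrow> 'a::comm_ring_1"
  assumes J: "finite J" "card J < m"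
  shows "det (mat m m (\<lambda>(s, t). \<Sum>j\<in>J. f s j * g j t)) = 0"
proof -
  obtain h where h: "bij_betw h {0..<card J} J" using ex_bij_betw_nat_finite[OF J(1)] by blast
  define P where "P = mat m m (\<lambda>(s, l). f s (h l))"
  define Q where "Q = mat m m (\<lambda>(l, t). if l < card J then g (h l) t else 0)"
  have car: "P \<in> carrier_mat m m" "Q \<in> carrier_mat m m" by (auto simp: P_def Q_def)
  have "mat m m (\<lambda>(s, t). \<Sum>j\<in>J. f s j * g j t) = P * Q"
  proof (rule eq_matI)
    fix s t assume "s < dim_row (P * Q)" "t < dim_col (P * Q)"
    then have st: "s < m" "t < m" using car by auto
    have "(P * Q) $$ (s, t) = (\<Sum>l = 0..<m. f s (h l) * (if l < card J then g (h l) t else 0))"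
      using st by (simp add: P_def Q_def scalar_prod_def)
    also have "\<dots> = (\<Sum>l = 0..<card J. f s (h l) * g (h l) t)"
      using J(2) by (intro sum.mono_neutral_cong_right) auto
    also have "\<dots> = (\<Sum>j\<in>J. f s j * g j t)"
      using sum.reindex_bij_betw[OF h, of "\<lambda>j. f s j * g j t"] .
    finally show "mat m m (\<lambda>(s, t). \<Sum>j\<in>J. f s j * g j t) $$ (s, t) = (P * Q) $$ (s, t)"
      using st by simp
  qed (use car in auto)
  moreover have "det Q = 0"
  proof -
    have "(\<Prod>l = 0..<m. Q $$ (l, \<pi> l)) = 0" if "\<pi> permutes {0..<m}" for \<pi>
      using J(2) permutes_in_image[OF that, of "card J"]
      by (intro prod_zero bexI[of _ "card J"]) (auto simp: Q_def)
    then show ?thesis unfolding det_def'[OF car(2)] by (intro sum.neutral) auto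
  qed
  ultimately show ?thesis by (simp add: det_mult[OF car])
qed

text \<open>
  In the product \<open>A = b P c\<close> of a double coset element, an entry with row \<open>\<ge> i\<close> and column \<open>\<le> k\<close> is a sum
  over the ones of the permutation matrix \<open>P\<close>. Triangularity of \<open>b\<close> and \<open>c\<close> kills the ones outside the
  block, so \<open>r\<^sub>y(i, k)\<close> summands remain, and a larger minor is zero.
\<close>

lemma bruhat_le_imp_rank_count_le:
  assumes x: "x permutes {1..n}" and y: "y permutes {1..n}"
    and le: "bruhat_le TYPE('a::alg_closed_field) n x y" and k: "k \<in> {1..n}"
  shows "rank_count x i k \<le> rank_count y i k"
proof (rule ccontr)
  define m where "m = rank_count x i k"
  assume "\<not> rank_count x i k \<le> rank_count y i k"
  then have lt: "rank_count y i k < m" by (simp add: m_def)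
  define C where "C = {j \<in> {1..k}. i \<le> x j}"
  have "card C = m" by (simp add: C_def m_def rank_count_def)
  then obtain h where h: "bij_betw h {0..<m} C"
    using ex_bij_betw_nat_finite[of C] by (auto simp: C_def)
  have hC: "h s \<in> {1..n}" "h s \<le> k" "i \<le> x (h s)" "x (h s) \<in> {1..n}" if "s < m" for s
  proof -
    have "h s \<in> C" using h that by (auto simp: bij_betw_def)
    then show "h s \<in> {1..n}" "h s \<le> k" "i \<le> x (h s)" using k by (auto simp: C_def)
    then show "x (h s) \<in> {1..n}" using permutes_in_image[OF x] by blast
  qed
  have pred: "h s - 1 < n" "Suc (h s - 1) = h s" "x (h s) - 1 < n" "Suc (x (h s) - 1) = x (h s)"
    if "s < m" for s
    using hC[OF that] by auto
  \<comment> \<open>The minor in the rows and columns of the ones of \<open>x\<close> in the block; columns and rows are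
    matched by \<open>h\<close>, so that on the matrix of \<open>x\<close> it becomes the determinant of an identity matrix.\<close>
  define f where "f = (\<lambda>A :: 'a mat. det (mat m m (\<lambda>(s, t). A $$ (x (h s) - 1, h t - 1))))"
  have "f \<in> poly_fun n"
    unfolding f_def by (rule poly_fun_minor) (simp_all only: pred)
  moreover have "f A = 0" if A_in: "A \<in> double_coset n y" for A
  proof -
    obtain b c where A: "A = b * perm_matrix n y * c"
      and b: "b \<in> borel_subgroup n" and c: "c \<in> borel_subgroup n"
      using A_in unfolding double_coset_def by blast
    define J where "J = {j. j < n \<and> Suc j \<le> k \<and> i \<le> y (Suc j)}"
    have "bij_betw Suc J {j \<in> {1..k}. i \<le> y j}"
      using k by (intro bij_betwI[of _ _ _ "\<lambda>j. j - 1"]) (auto simp: J_def)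
    then have cardJ: "card J < m" using lt bij_betw_same_card by (fastforce simp only: rank_count_def)
    have "A $$ (x (h s) - 1, h t - 1) =
        (\<Sum>j\<in>J. b $$ (x (h s) - 1, y (Suc j) - 1) * c $$ (j, h t - 1))" if st: "s < m" "t < m" for s t
    proof -
      have "A $$ (x (h s) - 1, h t - 1) =
          (\<Sum>j<n. b $$ (x (h s) - 1, y (Suc j) - 1) * c $$ (j, h t - 1))"
        unfolding A using b c borel_subgroup_carrier pred st
        by (intro double_coset_entry y) auto
      also have "\<dots> = (\<Sum>j\<in>J. b $$ (x (h s) - 1, y (Suc j) - 1) * c $$ (j, h t - 1))"
      proof (rule sum.mono_neutral_right)
        show "\<forall>j\<in>{..<n} - J. b $$ (x (h s) - 1, y (Suc j) - 1) * c $$ (j, h t - 1) = 0"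
        proof
          fix j assume j: "j \<in> {..<n} - J"
          then consider "k < Suc j" | "y (Suc j) < i" by (auto simp: J_def)
          then show "b $$ (x (h s) - 1, y (Suc j) - 1) * c $$ (j, h t - 1) = 0"
          proof cases
            case 1
            then have "h t - 1 < j" using hC[OF st(2)] by auto
            then show ?thesis using borel_subgroup_lower[OF c] j by simp
          next
            case 2
            then have "y (Suc j) - 1 < x (h s) - 1"
              using hC(3)[OF st(1)] permutes_pred(2)[OF y, of j] j by auto
            then show ?thesis using borel_subgroup_lower[OF b] pred(3)[OF st(1)] by simp
          qed
        qed
      qed (auto simp: J_def)
      finally show ?thesis .
    qed
    then have "mat m m (\<lambda>(s, t). A $$ (x (h s) - 1, h t - 1)) =
      mat m m (\<lambda>(s, t). \<Sum>j\<in>J. b $$ (x (h s) - 1, y (Suc j) - 1) * c $$ (j, h t - 1))"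
      by (intro eq_matI) auto
    then show "f A = 0"
      unfolding f_def using det_eq_0_if_factors[of J m] cardJ by (simp add: J_def)
  qed
  moreover have "perm_matrix n x \<in> Abstract_Topology.closure_of (zariski_GL n) (double_coset n y :: 'a mat set)"
    using le perm_matrix_in_double_coset unfolding bruhat_le_def by blast
  ultimately have "f (perm_matrix n x) = 0"
    unfolding in_closure_zariski_GL_iff[OF double_coset_subset_GL[OF y]] by blast
  moreover have "mat m m (\<lambda>(s, t). perm_matrix n x $$ (x (h s) - 1, h t - 1)) = (1\<^sub>m m :: 'a mat)"
  proof (rule eq_matI)
    fix s t assume "s < dim_row (1\<^sub>m m :: 'a mat)" "t < dim_col (1\<^sub>m m :: 'a mat)"
    then have st: "s < m" "t < m" by auto
    have "x (h t) = x (h s) \<longleftrightarrow> s = t"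
      using st h permutes_inj[OF x] by (auto simp: bij_betw_def dest!: injD inj_onD)
    then show "mat m m (\<lambda>(s, t). perm_matrix n x $$ (x (h s) - 1, h t - 1)) $$ (s, t) =
        (1\<^sub>m m :: 'a mat) $$ (s, t)"
      using st pred[OF st(1)] pred[OF st(2)] by (simp add: perm_matrix_def)
  qed auto
  ultimately show False by (simp add: f_def)
qed

section \<open>A transposition that raises a permutation enlarges the closure\<close>

lemma bruhat_le_refl:
  assumes "x permutes {1..n}"
  shows "bruhat_le TYPE('a::alg_closed_field) n x x"
  unfolding bruhat_le_def
  using double_coset_subset_GL[OF assms] by (intro closure_of_subset) (simp only: topspace_zariski_GL)

lemma bruhat_le_trans:
  assumes "bruhat_le TYPE('a::alg_closed_field) n x y" "bruhat_le TYPE('a) n y z"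
  shows "bruhat_le TYPE('a) n x z"
  using assms unfolding bruhat_le_def
  by (meson closedin_closure_of closure_of_minimal subset_trans)

text \<open>
  In rows \<open>x p < x q\<close> and columns \<open>p < q\<close> the matrix on the left is \<open>[1 0; t 1]\<close>, and elsewhere it is the
  matrix of \<open>x\<close>. Since \<open>x \<circ> transpose p q\<close> has the antidiagonal block \<open>[0 1; 1 0]\<close> there, the
  factorisation \<open>[1 0; t 1] = [-1/t 1; 0 t] [0 1; 1 0] [1 1/t; 0 1]\<close> yields the upper triangular factors.
\<close>

lemma perm_matrix_curve_in_double_coset:
  fixes t :: "'a::field"
  assumes x: "x permutes {1..n}" and p: "1 \<le> p" and pq: "p < q" and q: "q \<le> n"
    and xpq: "x p < x q" and t: "t \<noteq> 0"
  shows "perm_matrix n x + t \<cdot>\<^sub>m mat n n (\<lambda>(i, j). if i = x q - 1 \<and> j = p - 1 then 1 else 0)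
    \<in> double_coset n (x \<circ> transpose p q)"
proof -
  let ?x' = "x \<circ> transpose p q"
  have x': "?x' permutes {1..n}"
    using p pq q x by (intro permutes_compose permutes_swap_id) auto
  have "p \<in> {1..n}" "q \<in> {1..n}" using p pq q by auto
  then have xin: "x p \<in> {1..n}" "x q \<in> {1..n}" using permutes_in_image[OF x] by blast+
  obtain u w where u: "x p = Suc u" and w: "x q = Suc w"
    using xin by (cases "x p"; cases "x q") auto
  define b where "b = mat n n (\<lambda>(i, j).
    if i = j then (if i = x q - 1 then t else if i = x p - 1 then - 1 / t else 1)
    else if i = x p - 1 \<and> j = x q - 1 then 1 else 0)"
  define c where "c = mat n n (\<lambda>(i, j).
    if i = j then 1 else if i = p - 1 \<and> j = q - 1 then 1 / t else 0)"
  have b_car: "b \<in> carrier_mat n n" and c_car: "c \<in> carrier_mat n n" by (auto simp: b_def c_def)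
  have b: "b \<in> borel_subgroup n"
    using t xin xpq by (intro borel_subgroupI b_car upper_triangularI) (auto simp: b_def)
  have c: "c \<in> borel_subgroup n"
    using p pq by (intro borel_subgroupI c_car upper_triangularI) (auto simp: c_def)
  have "perm_matrix n x + t \<cdot>\<^sub>m mat n n (\<lambda>(i, j). if i = x q - 1 \<and> j = p - 1 then 1 else 0)
      = b * perm_matrix n ?x' * c" (is "?L = ?R")
  proof (rule eq_matI)
    fix i k assume "i < dim_row ?R" "k < dim_col ?R"
    then have ik: "i < n" "k < n" using b_car c_car by auto
    let ?b = "\<lambda>v. b $$ (i, v - 1)"
    \<comment> \<open>Multiplying by \<open>c\<close> on the right adds \<open>1/t\<close> times column \<open>p\<close> to column \<open>q\<close>.\<close>
    have "?R $$ (i, k) = (\<Sum>j<n. ?b (?x' (Suc j)) * c $$ (j, k))"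
      by (rule double_coset_entry[OF x' b_car c_car ik])
    also have "\<dots> = (\<Sum>j<n. (if j = k then ?b (?x' (Suc j)) else 0) +
        (if j = p - 1 then (if k = q - 1 then ?b (?x' (Suc j)) / t else 0) else 0))"
      using ik p pq by (intro sum.cong) (auto simp: c_def)
    also have "\<dots> = ?b (?x' (Suc k)) + (if k = q - 1 then ?b (x q) / t else 0)"
      using ik p pq q by (simp add: sum.distrib)
    finally have R: "?R $$ (i, k) = ?b (?x' (Suc k)) + (if k = q - 1 then ?b (x q) / t else 0)" .
    have b_entry: "?b v = (if Suc i = v then (if v = x q then t else if v = x p then - 1 / t else 1)
        else if Suc i = x p \<and> v = x q then 1 else 0)" if "v \<in> {1..n}" for v
      using that ik u w by (cases v) (auto simp: b_def)
    have L: "?L $$ (i, k) = (if x (Suc k) = Suc i then 1 else 0) +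
        (if Suc i = x q \<and> Suc k = p then t else 0)"
      using ik p w by (cases p) (auto simp: perm_matrix_def)
    consider "Suc k = p" | "Suc k = q" | "Suc k \<noteq> p" "Suc k \<noteq> q" by blast
    then show "?L $$ (i, k) = ?R $$ (i, k)"
    proof cases
      case 1
      then show ?thesis unfolding L R using b_entry[OF xin(2)] pq xpq by auto
    next
      case 2
      then show ?thesis unfolding L R using b_entry[OF xin(1)] b_entry[OF xin(2)] pq xpq t by auto
    next
      case 3
      have "x (Suc k) \<in> {1..n}" using permutes_in_image[OF x, of "Suc k"] ik by simp
      note entry = b_entry[OF this]
      have "x (Suc k) \<noteq> x p" "x (Suc k) \<noteq> x q" using 3 permutes_inj[OF x] by (auto dest: injD)
      then have "?b (x (Suc k)) = (if x (Suc k) = Suc i then 1 else 0)"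
        unfolding entry by (simp add: eq_commute[of "Suc i"])
      moreover have "k \<noteq> q - 1" using 3 pq by auto
      moreover have "?x' (Suc k) = x (Suc k)" using 3 by (simp add: transpose_def)
      ultimately show ?thesis unfolding L R using 3 by simp
    qed
  qed (use b_car c_car in auto)
  then show ?thesis using b c unfolding double_coset_def by blast
qed

text \<open>
  Given \<open>A = b X c\<close>, the curve \<open>b (X + t E) c\<close> is affine in \<open>t\<close>, passes through \<open>A\<close> at \<open>t = 0\<close> and lies in
  the double coset of the swapped permutation for all other \<open>t\<close>.
\<close>

lemma bruhat_le_swap:
  assumes x: "x permutes {1..n}" and p: "1 \<le> p" and pq: "p < q" and q: "q \<le> n" and xpq: "x p < x q"
  shows "bruhat_le TYPE('a::alg_closed_field) n x (x \<circ> transpose p q)"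
proof -
  let ?x' = "x \<circ> transpose p q"
  let ?X = "perm_matrix n x :: 'a mat"
  let ?E = "mat n n (\<lambda>(i, j). if i = x q - 1 \<and> j = p - 1 then 1 else 0) :: 'a mat"
  have x': "?x' permutes {1..n}"
    using p pq q x by (intro permutes_compose permutes_swap_id) auto
  have "A \<in> Abstract_Topology.closure_of (zariski_GL n) (double_coset n ?x')" if A: "A \<in> double_coset n x" for A :: "'a mat"
    unfolding in_closure_zariski_GL_iff[OF double_coset_subset_GL[OF x']]
  proof (intro conjI ballI impI)
    show "A \<in> GL n" using A double_coset_subset_GL[OF x] by blast
    fix f :: "'a mat \<Rightarrow> 'a"
    assume f: "f \<in> poly_fun n" and f0: "\<forall>B\<in>double_coset n ?x'. f B = 0"
    obtain b c where A_eq: "A = b * ?X * c" and b: "b \<in> borel_subgroup n" and c: "c \<in> borel_subgroup n"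
      using A by (auto simp: double_coset_def)
    note car = borel_subgroup_carrier[OF b] borel_subgroup_carrier[OF c]
    define M where "M = (\<lambda>t. b * (?X + t \<cdot>\<^sub>m ?E) * c)"
    have M_eq: "M t = A + t \<cdot>\<^sub>m (b * ?E * c)" for t
    proof -
      have "M t = (b * ?X + b * (t \<cdot>\<^sub>m ?E)) * c"
        unfolding M_def using car by (subst mult_add_distrib_mat[of _ n n _ n]) auto
      also have "\<dots> = b * ?X * c + b * (t \<cdot>\<^sub>m ?E) * c"
        using car by (intro add_mult_distrib_mat[of _ n n]) auto
      also have "b * (t \<cdot>\<^sub>m ?E) = t \<cdot>\<^sub>m (b * ?E)"
        using car by (intro mult_smult_distrib[of _ n n _ n]) auto
      also have "t \<cdot>\<^sub>m (b * ?E) * c = t \<cdot>\<^sub>m (b * ?E * c)"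
        using car by (intro mult_smult_assoc_mat[of _ n n _ n]) auto
      finally show ?thesis by (simp add: A_eq)
    qed
    have "f (M 0) = 0"
    proof (rule poly_fun_vanishes_at_limit[OF f])
      fix i j assume ij: "i < n" "j < n"
      show "\<exists>p. \<forall>t. M t $$ (i, j) = poly p t"
        using car ij by (intro exI[of _ "[:A $$ (i, j), (b * ?E * c) $$ (i, j):]"]) (simp add: M_eq)
    next
      fix t :: 'a assume "t \<noteq> 0"
      then show "f (M t) = 0"
        using f0 perm_matrix_curve_in_double_coset[OF assms] double_coset_mult[OF _ b c]
        unfolding M_def by blast
    qed
    moreover have "M 0 = A"
      unfolding M_eq using car by (intro eq_matI) (auto simp: A_eq)
    ultimately show "f A = 0" by simp
  qed
  then show ?thesis unfolding bruhat_le_def by blast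
qed

theorem corollary5p13:
  fixes n :: nat and x y :: "nat \<Rightarrow> nat"
  assumes "n \<ge> 1" and "x permutes {1..n}" and "y permutes {1..n}"
  shows "bruhat_le TYPE('a::alg_closed_field) n x y \<longleftrightarrow> deodhar_le n x y"
proof
  assume "bruhat_le TYPE('a) n x y"
  then show "deodhar_le n x y"
    unfolding deodhar_le_iff_rank_count
    using bruhat_le_imp_rank_count_le[OF assms(2,3)] by blast
next
  assume "deodhar_le n x y"
  then have "\<forall>k\<in>{1..n}. \<forall>i. rank_count x i k \<le> rank_count y i k"
    by (simp only: deodhar_le_iff_rank_count)
  with assms(2,3) show "bruhat_le TYPE('a) n x y"
  proof (induction rule: rank_count_le_induct)
    case refl
    show ?case using assms(3) by (rule bruhat_le_refl)
  next
    case (swap x p q)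
    then show ?case using bruhat_le_swap bruhat_le_trans by blast
  qed
qed

end
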